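(* Let $\alpha_1,\alpha_2\in[0,1]$ with $\alpha_1+\alpha_2=1$. Consider the Riemann problem of the kinematic wave model of diverging traffic with one upstream link $0$ and two downstream links $1,2$, with initial states $U_0=(D_0,S_0)$ on link $0$ and $U_i=(D_i,S_i)$ on link $i$ ($i=1,2$). The boundary fluxes satisfying the entropy condition $$q_i=\min\{S_i(0^+,t),\ \max\{D_0(0^-,t)-S_j(0^+,t),\ \alpha_i D_0(0^-,t)\}\}\quad (i,j\in\{1,2\},\ i\ne j),$$ the traffic conservation equations, and the admissible conditions on stationary and interior states are given by $$q_i=\min\{S_i,\ \max\{D_0-S_j,\ \alpha_i D_0\}\}\quad (i,j\in\{1,2\},\ i\neq j),$$ and $q_0=\min\{D_0,\ S_1+S_2\}$.
   Context: Network and model. A diverge has one upstream link $0$ (coordinate $x_0\in(-\infty,0)$) and two downstream links $1,2$ (coordinates $x_i\in(0,\infty)$), meeting at $x=0$. In this model vehicles have no predefined routes. Each link $a$ is homogeneous with a unimodal flow-density relation $q=Q_a(\rho)=\rho V_a(\rho)$, critical density $\rho_{c,a}$, and capacity $C_a=Q_a(\rho_{c,a})>0$; traffic on link $a$ obeys $\partial_t\rho+\partial_x Q_a(\rho)=0$. The Riemann problem has constant initial density on each link. Supply-demand space. Demand and supply on link $a$ are $D(\rho)=Q_a(\min\{\rho,\rho_{c,a}\})$ and $S(\rho)=Q_a(\max\{\rho,\rho_{c,a}\})$. A traffic state on link $a$ is represented as a pair $U=(D,S)$ with $0\le D,S\le C_a$ and $\max\{D,S\}=C_a$; its flow-rate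 is $q(U)=\min\{D,S\}$. A state is under-critical (UC) if $S=C_a$, over-critical (OC) if $D=C_a$, strictly under-critical (SUC) if $D<S=C_a$, strictly over-critical (SOC) if $S<D=C_a$. The initial states are $U_0=(D_0,S_0)$ and $U_i=(D_i,S_i)$. Unknowns (for $t>0$): stationary states $U_0^-=(D_0^-,S_0^-)$ on link $0$ and $U_i^+=(D_i^+,S_i^+)$ on link $i$; interior states at the junction $U_0(0^-,t)=(D_0(0^-,t),S_0(0^-,t))$ (a state on link $0$) and $U_i(0^+,t)=(D_i(0^+,t),S_i(0^+,t))$ (a state on link $i$), $i=1,2$. Boundary fluxes and traffic conservation: $q_0=q(U_0^-)$, $q_i=q(U_i^+)$, $q_0=q_1+q_2$. Admissible conditions for stationary states: $U_0^-=(D_0,C_0)$, or $U_0^-=(C_0,S_0^-)$ with $S_0^-<D_0$; and $U_i^+=(C_i,S_i)$, or $U_i^+=(D_i^+,C_i)$ with $D_i^+<S_i$. Admissible conditions for interior states: if $U_0^-$ is SOC then $U_0(0^-,t)=U_0^-$; if $U_0^-$ is UC then $U_0(0^-,t)$ is any state on link $0$ with $S_0(0^-,t)\ge D_0^-$; if $U_i^+$ is SUC then $U_i(0^+,t)=U_i^+$; if $U_i^+$ is OC then $U_i(0^+,t)$ is any state on link $i$ with $D_i(0^+,t)\ge S_i^+$. *)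

theory Defs
  imports Complex_Main
begin

text \<open>
  Links are indexed by natural numbers: 0 is the upstream link, 1 and 2 are the downstream ones.
  A link is given by its speed-density relation and its critical density.
\<close>

record link =
  speed :: "real \<Rightarrow> real"
  crit :: real

definition flow :: "link \<Rightarrow> real \<Rightarrow> real" where
  "flow L \<rho> = \<rho> * speed L \<rho>"

definition capacity :: "link \<Rightarrow> real" where
  "capacity L = flow L (crit L)"

text \<open>
  Unimodality is required in the weak sense and on all nonnegative densities. A relation given
  only up to a jam density is covered by setting the speed to zero beyond it.
\<close>

definition unimodal_link :: "link \<Rightarrow> bool" where
  "unimodal_link L \<longleftrightarrow>
     0 < crit L \<and> 0 < capacity L \<and>
     (\<forall>\<rho>\<ge>0. 0 \<le> flow L \<rho>) \<and>
     (\<forall>\<rho> \<rho>'. 0 \<le> \<rho> \<and> \<rho> \<le> \<rho>' \<and> \<rho>' \<le> crit L \<longrightarrow> flow L \<rho> \<le> flow L \<rho>') \<and>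
     (\<forall>\<rho> \<rho>'. crit L \<le> \<rho> \<and> \<rho> \<le> \<rho>' \<longrightarrow> flow L \<rho>' \<le> flow L \<rho>)"

text \<open>Traffic states in supply-demand space are pairs (demand, supply).\<close>

type_synonym state = "real \<times> real"

abbreviation dem :: "state \<Rightarrow> real" where "dem \<equiv> fst"
abbreviation supl :: "state \<Rightarrow> real" where "supl \<equiv> snd"

definition is_state :: "link \<Rightarrow> state \<Rightarrow> bool" where
  "is_state L U \<longleftrightarrow>
     0 \<le> dem U \<and> dem U \<le> capacity L \<and> 0 \<le> supl U \<and> supl U \<le> capacity L \<and>
     max (dem U) (supl U) = capacity L"

definition state_of_density :: "link \<Rightarrow> real \<Rightarrow> state" where
  "state_of_density L \<rho> = (flow L (min \<rho> (crit L)), flow L (max \<rho> (crit L)))"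

lemma is_state_state_of_density:
  assumes "unimodal_link L" "0 \<le> \<rho>"
  shows "is_state L (state_of_density L \<rho>)"
  using assms
  by (auto simp: is_state_def state_of_density_def unimodal_link_def capacity_def min_def max_def
      intro: antisym)

definition flow_rate :: "state \<Rightarrow> real" where
  "flow_rate U = min (dem U) (supl U)"

definition under_critical :: "link \<Rightarrow> state \<Rightarrow> bool" where
  "under_critical L U \<longleftrightarrow> supl U = capacity L"

definition over_critical :: "link \<Rightarrow> state \<Rightarrow> bool" where
  "over_critical L U \<longleftrightarrow> dem U = capacity L"

definition strictly_under_critical :: "link \<Rightarrow> state \<Rightarrow> bool" where
  "strictly_under_critical L U \<longleftrightarrow> dem U < supl U \<and> supl U = capacity L"

definition strictly_over_critical :: "link \<Rightarrow> state \<Rightarrow> bool" where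
  "strictly_over_critical L U \<longleftrightarrow> supl U < dem U \<and> dem U = capacity L"

text \<open>
  In what follows \<open>U a\<close> is the initial state on link \<open>a\<close>, \<open>W a\<close> the stationary state on link
  \<open>a\<close> (upstream: minus superscript, downstream: plus superscript), \<open>Z a t\<close> the interior state on
  link \<open>a\<close> at the junction at time \<open>t > 0\<close>, and \<open>q a\<close> the boundary flux on link \<open>a\<close>. Stationary
  states and boundary fluxes do not depend on time; interior states may.
\<close>

definition boundary_fluxes :: "(nat \<Rightarrow> state) \<Rightarrow> (nat \<Rightarrow> real) \<Rightarrow> bool" where
  "boundary_fluxes W q \<longleftrightarrow> (\<forall>a\<in>{0,1,2}. q a = flow_rate (W a))"

definition traffic_conservation :: "(nat \<Rightarrow> real) \<Rightarrow> bool" where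
  "traffic_conservation q \<longleftrightarrow> q 0 = q 1 + q 2"

definition stationary_upstream :: "link \<Rightarrow> state \<Rightarrow> state \<Rightarrow> bool" where
  "stationary_upstream L U W \<longleftrightarrow> is_state L W \<and>
     (W = (dem U, capacity L) \<or> (dem W = capacity L \<and> supl W < dem U))"

definition stationary_downstream :: "link \<Rightarrow> state \<Rightarrow> state \<Rightarrow> bool" where
  "stationary_downstream L U W \<longleftrightarrow> is_state L W \<and>
     (W = (capacity L, supl U) \<or> (supl W = capacity L \<and> dem W < supl U))"

definition admissible_stationary ::
    "(nat \<Rightarrow> link) \<Rightarrow> (nat \<Rightarrow> state) \<Rightarrow> (nat \<Rightarrow> state) \<Rightarrow> bool" where
  "admissible_stationary L U W \<longleftrightarrow>
     stationary_upstream (L 0) (U 0) (W 0) \<and>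
     (\<forall>i\<in>{1,2}. stationary_downstream (L i) (U i) (W i))"

definition interior_upstream :: "link \<Rightarrow> state \<Rightarrow> state \<Rightarrow> bool" where
  "interior_upstream L W Z \<longleftrightarrow> is_state L Z \<and>
     (strictly_over_critical L W \<longrightarrow> Z = W) \<and>
     (under_critical L W \<longrightarrow> supl Z \<ge> dem W)"

definition interior_downstream :: "link \<Rightarrow> state \<Rightarrow> state \<Rightarrow> bool" where
  "interior_downstream L W Z \<longleftrightarrow> is_state L Z \<and>
     (strictly_under_critical L W \<longrightarrow> Z = W) \<and>
     (over_critical L W \<longrightarrow> dem Z \<ge> supl W)"

definition admissible_interior ::
    "(nat \<Rightarrow> link) \<Rightarrow> (nat \<Rightarrow> state) \<Rightarrow> (nat \<Rightarrow> real \<Rightarrow> state) \<Rightarrow> bool" where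
  "admissible_interior L W Z \<longleftrightarrow>
     (\<forall>t>0. interior_upstream (L 0) (W 0) (Z 0 t) \<and>
            (\<forall>i\<in>{1,2}. interior_downstream (L i) (W i) (Z i t)))"

definition entropy_condition ::
    "(nat \<Rightarrow> real) \<Rightarrow> (nat \<Rightarrow> real \<Rightarrow> state) \<Rightarrow> (nat \<Rightarrow> real) \<Rightarrow> bool" where
  "entropy_condition \<alpha> Z q \<longleftrightarrow>
     (\<forall>t>0. \<forall>i\<in>{1,2}. \<forall>j\<in>{1,2}. i \<noteq> j \<longrightarrow>
        q i = min (supl (Z i t)) (max (dem (Z 0 t) - supl (Z j t)) (\<alpha> i * dem (Z 0 t))))"

end

theory Submission imports Defs begin

text \<open>
  The key is that the \<open>min\<close>-\<open>max\<close> formula for the two outgoing fluxes is equivalent to a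
  complementarity system (lemma \<open>diverge_flux_iff\<close>): the total outflow is the smaller of the
  demand and the total supply, no flux exceeds its supply, and a flux strictly below its supply is
  at least its share \<open>\<alpha>\<^sub>i d\<close> of the demand \<open>d\<close>. In this form the
  interior data can be exchanged for the initial data one condition at a time.

  The admissible conditions offer each link two alternatives. Either the flux equals the initial
  demand (upstream) or supply (downstream), or it is strictly smaller; in the second case the
  stationary state pins the interior state, whose demand (upstream) or supply (downstream) is then
  the full capacity. In every case \<open>q\<^sub>0 \<le> D\<^sub>0\<close> and \<open>q\<^sub>i \<le> S\<^sub>i\<close>; the rest of the system for the
  initial data follows from the one for the interior data.

  \<^item> Downstream, if \<open>q\<^sub>i < S\<^sub>i\<close>, then the interior supply \<open>C\<^sub>i\<close> also exceeds \<open>q\<^sub>i\<close>, so the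
    complementarity condition is active for both pairs of data. It gives \<open>q\<^sub>i \<ge> \<alpha>\<^sub>i d\<close> for the
    interior demand \<open>d\<close>. Moreover \<open>d \<ge> D\<^sub>0\<close>, since either \<open>D\<^sub>0 = q\<^sub>0 \<le> d\<close> or
    \<open>d = C\<^sub>0 \<ge> D\<^sub>0\<close>, so \<open>q\<^sub>i \<ge> \<alpha>\<^sub>i D\<^sub>0\<close>.
  \<^item> Upstream, if \<open>q\<^sub>0 < D\<^sub>0\<close>, then \<open>q\<^sub>0 < C\<^sub>0 = d\<close>, so the total interior supply is the bottleneck
    and both downstream fluxes equal their interior supplies. A flux \<open>q\<^sub>i < S\<^sub>i\<close> would then
    equal \<open>C\<^sub>i \<ge> S\<^sub>i\<close>, so \<open>q\<^sub>i = S\<^sub>i\<close> and \<open>q\<^sub>0 = S\<^sub>1 + S\<^sub>2\<close>. If \<open>q\<^sub>0 = D\<^sub>0\<close>, then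
    \<open>q\<^sub>0 = q\<^sub>1 + q\<^sub>2 \<le> S\<^sub>1 + S\<^sub>2\<close>. Either way, \<open>q\<^sub>0 = min D\<^sub>0 (S\<^sub>1 + S\<^sub>2)\<close>.

  Conversely, from fluxes given by the initial data, the alternative that applies on each link
  prescribes a stationary state, and this state can serve as the interior state as well.
\<close>

section \<open>The flux formula as a complementarity system\<close>

text \<open>
  Here \<open>a\<^sub>i\<close> is the share of the demand \<open>d\<close> that is intended for link \<open>i\<close>. If both shares fit,
  both are realised. If only \<open>a\<^sub>1\<close> exceeds its supply, link 1 is filled up to \<open>s\<^sub>1\<close> and link 2
  takes the rest \<open>d - s\<^sub>1 \<ge> a\<^sub>2\<close>, as far as it can.
\<close>

lemma diverge_flux_iff:
  fixes d a1 a2 s1 s2 x1 x2 :: real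
  assumes "a1 + a2 = d"
  shows "x1 = min s1 (max (d - s2) a1) \<and> x2 = min s2 (max (d - s1) a2) \<longleftrightarrow>
    x1 + x2 = min d (s1 + s2) \<and> x1 \<le> s1 \<and> x2 \<le> s2 \<and>
    (x1 < s1 \<longrightarrow> a1 \<le> x1) \<and> (x2 < s2 \<longrightarrow> a2 \<le> x2)"
  using assms unfolding min_def max_def by (smt (verit))

section \<open>Admissible states on a single link\<close>

lemma upstream_alternatives:
  assumes "is_state L U" "stationary_upstream L U W" "interior_upstream L W Z"
    and "flow_rate W \<le> dem Z"
  shows "dem U \<le> dem Z \<and>
    (flow_rate W = dem U \<or> (flow_rate W < dem U \<and> dem Z = capacity L))"
  using assms
  by (auto simp: is_state_def stationary_upstream_def interior_upstream_def flow_rate_def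
      strictly_over_critical_def under_critical_def min_def)

lemma downstream_alternatives:
  assumes "is_state L U" "stationary_downstream L U W" "interior_downstream L W Z"
  shows "flow_rate W = supl U \<or> (flow_rate W < supl U \<and> supl Z = capacity L)"
  using assms
  by (auto simp: is_state_def stationary_downstream_def interior_downstream_def flow_rate_def
      strictly_under_critical_def over_critical_def min_def)

text \<open>
  Witnesses for existence: a state with flux \<open>x\<close> that is both stationary and interior. If \<open>x\<close> is
  below the initial demand (upstream) or supply (downstream), the state is strictly over-critical
  upstream and strictly under-critical downstream, so no other interior state would be admissible.
\<close>

definition upstream_state :: "link \<Rightarrow> state \<Rightarrow> real \<Rightarrow> state" where
  "upstream_state L U x = (if x = dem U then (dem U, capacity L) else (capacity L, x))"

definition downstream_state :: "link \<Rightarrow> state \<Rightarrow> real \<Rightarrow> state" where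
  "downstream_state L U x = (if x = supl U then (capacity L, supl U) else (x, capacity L))"

lemma upstream_state_admissible:
  assumes "is_state L U" "0 \<le> x" "x \<le> dem U"
  shows "stationary_upstream L U (upstream_state L U x)"
    and "interior_upstream L (upstream_state L U x) (upstream_state L U x)"
    and "flow_rate (upstream_state L U x) = x"
  using assms
  by (auto simp: is_state_def stationary_upstream_def interior_upstream_def flow_rate_def
      under_critical_def upstream_state_def)

lemma downstream_state_admissible:
  assumes "is_state L U" "0 \<le> x" "x \<le> supl U"
  shows "stationary_downstream L U (downstream_state L U x)"
    and "interior_downstream L (downstream_state L U x) (downstream_state L U x)"
    and "flow_rate (downstream_state L U x) = x"
  using assms
  by (auto simp: is_state_def stationary_downstream_def interior_downstream_def flow_rate_def
      over_critical_def downstream_state_def)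

section \<open>Boundary fluxes of the diverge\<close>

theorem theorem5p4:
  fixes L :: "nat \<Rightarrow> link" and U :: "nat \<Rightarrow> state"
    and \<alpha> :: "nat \<Rightarrow> real" and q :: "nat \<Rightarrow> real"
  assumes "\<forall>a\<in>{0,1,2}. unimodal_link (L a)"
    and "\<forall>a\<in>{0,1,2}. is_state (L a) (U a)"
    and "\<forall>i\<in>{1,2}. 0 \<le> \<alpha> i \<and> \<alpha> i \<le> 1"
    and "\<alpha> 1 + \<alpha> 2 = 1"
  shows "(\<exists>W Z. boundary_fluxes W q \<and> traffic_conservation q \<and>
            admissible_stationary L U W \<and> admissible_interior L W Z \<and>
            entropy_condition \<alpha> Z q)
         \<longleftrightarrow>
         (\<forall>i\<in>{1,2}. \<forall>j\<in>{1,2}. i \<noteq> j \<longrightarrow>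
            q i = min (supl (U i)) (max (dem (U 0) - supl (U j)) (\<alpha> i * dem (U 0)))) \<and>
         q 0 = min (dem (U 0)) (supl (U 1) + supl (U 2))"
    (is "?solution \<longleftrightarrow> ?formula")
proof -
  let ?D = "dem (U 0)" and ?S = "\<lambda>i. supl (U i)" and ?C = "\<lambda>a. capacity (L a)"
  have U: "is_state (L 0) (U 0)" "is_state (L 1) (U 1)" "is_state (L 2) (U 2)"
    using assms(2) by auto
  then have bounds: "0 \<le> ?D" "?D \<le> ?C 0" "0 \<le> ?S 1" "?S 1 \<le> ?C 1" "0 \<le> ?S 2" "?S 2 \<le> ?C 2"
    by (auto simp: is_state_def)
  have \<alpha>: "0 \<le> \<alpha> 1" "0 \<le> \<alpha> 2" using assms(3) by auto
  have shares: "\<alpha> 1 * d + \<alpha> 2 * d = d" for d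
    using assms(4) by (metis distrib_right mult_1)
  have formula_iff: "?formula \<longleftrightarrow> q 0 = q 1 + q 2 \<and> q 0 = min ?D (?S 1 + ?S 2) \<and>
      q 1 \<le> ?S 1 \<and> q 2 \<le> ?S 2 \<and>
      (q 1 < ?S 1 \<longrightarrow> \<alpha> 1 * ?D \<le> q 1) \<and> (q 2 < ?S 2 \<longrightarrow> \<alpha> 2 * ?D \<le> q 2)"
    using diverge_flux_iff[OF shares, of "q 1" "?S 1" ?D "?S 2" "q 2"] by auto
  have entropy_iff: "entropy_condition \<alpha> Z q \<longleftrightarrow> (\<forall>t>0.
      q 1 + q 2 = min (dem (Z 0 t)) (supl (Z 1 t) + supl (Z 2 t)) \<and>
      q 1 \<le> supl (Z 1 t) \<and> q 2 \<le> supl (Z 2 t) \<and>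
      (q 1 < supl (Z 1 t) \<longrightarrow> \<alpha> 1 * dem (Z 0 t) \<le> q 1) \<and>
      (q 2 < supl (Z 2 t) \<longrightarrow> \<alpha> 2 * dem (Z 0 t) \<le> q 2))" for Z
    unfolding diverge_flux_iff[OF shares, symmetric] entropy_condition_def by auto
  show ?thesis
  proof
    assume ?solution
    then obtain W Z where W: "boundary_fluxes W q" "traffic_conservation q"
        "admissible_stationary L U W" "admissible_interior L W Z"
      and Z: "entropy_condition \<alpha> Z q"
      by blast
    \<comment> \<open>The fluxes do not depend on time, so the interior states at one instant determine them.\<close>
    define d s1 s2 where "d = dem (Z 0 1)" and "s1 = supl (Z 1 1)" and "s2 = supl (Z 2 1)"
    have q: "q 0 = q 1 + q 2" "q 0 = flow_rate (W 0)" "q 1 = flow_rate (W 1)" "q 2 = flow_rate (W 2)"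
      using W(1,2) by (auto simp: boundary_fluxes_def traffic_conservation_def)
    have flux: "q 1 + q 2 = min d (s1 + s2)" "q 1 \<le> s1" "q 2 \<le> s2"
        "q 1 < s1 \<Longrightarrow> \<alpha> 1 * d \<le> q 1" "q 2 < s2 \<Longrightarrow> \<alpha> 2 * d \<le> q 2"
      using Z unfolding entropy_iff d_def s1_def s2_def by auto
    have up: "?D \<le> d" "q 0 = ?D \<or> (q 0 < ?D \<and> d = ?C 0)"
      using upstream_alternatives[OF U(1), of "W 0" "Z 0 1"] W(3,4) q flux(1)
      by (auto simp: admissible_stationary_def admissible_interior_def d_def)
    have down: "q 1 = ?S 1 \<or> (q 1 < ?S 1 \<and> s1 = ?C 1)"
               "q 2 = ?S 2 \<or> (q 2 < ?S 2 \<and> s2 = ?C 2)"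
      using downstream_alternatives[OF U(2), of "W 1" "Z 1 1"]
        downstream_alternatives[OF U(3), of "W 2" "Z 2 1"] W(3,4) q
      by (auto simp: admissible_stationary_def admissible_interior_def s1_def s2_def)
    have "\<alpha> 1 * ?D \<le> \<alpha> 1 * d" "\<alpha> 2 * ?D \<le> \<alpha> 2 * d"
      using up(1) \<alpha> by (auto intro: mult_left_mono)
    then have "q 1 < ?S 1 \<longrightarrow> \<alpha> 1 * ?D \<le> q 1" "q 2 < ?S 2 \<longrightarrow> \<alpha> 2 * ?D \<le> q 2"
      using down flux(4,5) bounds by linarith+
    moreover have "q 0 = min ?D (?S 1 + ?S 2)"
      using up(2)
    proof
      assume "q 0 = ?D"
      then show ?thesis using down q(1) by linarith
    next
      \<comment> \<open>The demand is not exhausted, so the interior supplies are, which excludes a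
        downstream link that passes less than its initial supply.\<close>
      assume less: "q 0 < ?D \<and> d = ?C 0"
      then have "q 1 = s1" "q 2 = s2" using flux(1-3) bounds(2) q(1) by linarith+
      then have "q 1 = ?S 1" "q 2 = ?S 2" using down bounds by linarith+
      then show ?thesis using less q(1) by linarith
    qed
    ultimately show ?formula unfolding formula_iff using q(1) down by auto
  next
    assume f: ?formula
    then have sum: "q 0 = q 1 + q 2" "q 0 = min ?D (?S 1 + ?S 2)"
      and le: "q 1 \<le> ?S 1" "q 2 \<le> ?S 2"
      and share: "q 1 < ?S 1 \<Longrightarrow> \<alpha> 1 * ?D \<le> q 1" "q 2 < ?S 2 \<Longrightarrow> \<alpha> 2 * ?D \<le> q 2"
      unfolding formula_iff by auto
    have "0 \<le> \<alpha> 1 * ?D" "0 \<le> \<alpha> 2 * ?D" using \<alpha> bounds by auto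
    then have nonneg: "0 \<le> q 1" "0 \<le> q 2" using le share bounds by linarith+
    define W where
      "W a = (if a = 0 then upstream_state (L 0) (U 0) (q 0)
              else downstream_state (L a) (U a) (q a))" for a
    have q0: "0 \<le> q 0" "q 0 \<le> ?D" using sum nonneg by linarith+
    note up = upstream_state_admissible[OF U(1) q0]
    note down1 = downstream_state_admissible[OF U(2) nonneg(1) le(1)]
    note down2 = downstream_state_admissible[OF U(3) nonneg(2) le(2)]
    have "boundary_fluxes W q" "traffic_conservation q" "admissible_stationary L U W"
        "admissible_interior L W (\<lambda>a t. W a)"
      using up down1 down2 sum(1)
      by (auto simp: W_def boundary_fluxes_def traffic_conservation_def
          admissible_stationary_def admissible_interior_def)
    moreover have "entropy_condition \<alpha> (\<lambda>a t. W a) q"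
    proof -
      have d: "dem (W 0) = (if q 0 = ?D then ?D else ?C 0)"
        and s1: "supl (W 1) = (if q 1 = ?S 1 then ?S 1 else ?C 1)"
        and s2: "supl (W 2) = (if q 2 = ?S 2 then ?S 2 else ?C 2)"
        by (auto simp: W_def upstream_state_def downstream_state_def)
      show ?thesis
      proof (cases "q 0 = ?D")
        case True
        then show ?thesis
          unfolding entropy_iff d s1 s2 using sum le share bounds by auto
      next
        case False
        then have "q 1 = ?S 1" "q 2 = ?S 2" using sum le by linarith+
        with False show ?thesis
          unfolding entropy_iff d s1 s2 using sum bounds by auto
      qed
    qed
    ultimately show ?solution by blast
  qed
qed

end
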